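(* Consider any gradient code with $N=K$ whose associated bipartite graph $\mathcal{G}$ is connected and regular (hence of degree $L$). Then for every integer $\eta$ with $0<\eta\le N/4$, the adversarial threshold satisfies $$S^{*}(\eta)\ \ge\ \left(\frac{3L-\lambda_2}{L+\lambda_2}\right)\eta,$$ where $\lambda_2$ is the second largest eigenvalue of (the adjacency matrix of) the graph $\mathcal{G}$.
   Context: A gradient code with $N$ workers and $K$ data parts is given by an encoding matrix $\mathbf{E}\in\mathbb{R}^{K\times N}$; $L$ is the maximum number of nonzero entries in a column (computation load), $R$ the minimum number of nonzero entries in a row. The associated bipartite graph $\mathcal{G}=(\mathcal{W},\mathcal{D},\mathcal{E})$ has left vertices $\mathcal{W}$ (the $N$ workers, i.e. columns of $\mathbf{E}$) and right vertices $\mathcal{D}$ (the $K$ gradients, i.e. rows of $\mathbf{E}$), with an edge between worker $i\in\mathcal{W}$ and gradient $j\in\mathcal{D}$ iff the entry of $\mathbf{E}$ in row $j$ and column $i$ is nonzero. For $\mathcal{T}\subseteq\mathcal{D}$, $\mathcal{N}(\mathcal{T})\subseteq\mathcal{W}$ is the set of neighbors of $\mathcal{T}$ in $\mathcal{G}$. For an integer $0<\eta<K$, the adversarial threshold is $$S^{*}(\eta):=\min_{\mathcal{T}\subset\mathcal{D},\,|\mathcal{T}|=\eta}|\mathcal{N}(\mathcal{T})|.$$ The eigenvalues of $\mathcal{G}$ are those of its $(N+K)\times(N+K)$ adjacency matrix, listed with multiplicity as $\lambda_1\ge\lambda_2\ge\cdots$. *)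

theory Defs
  imports
    "Jordan_Normal_Form.Char_Poly"
    "Graph_Theory.Digraph_Component"
    "HOL-Library.Multiset"
begin

text \<open>
  A gradient code is given by its encoding matrix \<open>E\<close>, whose rows are indexed by the gradients
  (data parts) and whose columns are indexed by the workers; \<open>E $$ (j, i)\<close> is the entry in row
  \<open>j\<close> and column \<open>i\<close>.
\<close>

definition computation_load :: "real mat \<Rightarrow> nat" where
  "computation_load E =
     Max ((\<lambda>i. card {j. j < dim_row E \<and> E $$ (j, i) \<noteq> 0}) ` {..<dim_col E})"

datatype vertex = Worker nat | Gradient nat

definition workers :: "real mat \<Rightarrow> vertex set" where
  "workers E = Worker ` {..<dim_col E}"

definition gradients :: "real mat \<Rightarrow> vertex set" where
  "gradients E = Gradient ` {..<dim_row E}"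

text \<open>
  As in \<open>Graph_Theory\<close>, an undirected simple graph is a symmetric loop-free digraph
  (see \<open>pair_graph_code_graph\<close> below): each edge is represented by its two orientations.
\<close>

definition code_edges :: "real mat \<Rightarrow> (vertex \<times> vertex) set" where
  "code_edges E = {(Worker i, Gradient j) | i j. i < dim_col E \<and> j < dim_row E \<and> E $$ (j, i) \<noteq> 0}"

definition code_graph :: "real mat \<Rightarrow> vertex pair_pre_digraph" where
  "code_graph E =
     \<lparr> pverts = workers E \<union> gradients E, parcs = code_edges E \<union> (code_edges E)\<inverse> \<rparr>"

lemma pair_graph_code_graph: "pair_graph (code_graph E)"
proof -
  have "code_edges E \<subseteq> workers E \<times> gradients E"
    by (auto simp: code_edges_def workers_def gradients_def)
  moreover have "finite (workers E)" "finite (gradients E)"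
    by (auto simp: workers_def gradients_def)
  ultimately have "finite (code_edges E)"
    by (meson finite_SigmaI finite_subset)
  then show ?thesis
    by unfold_locales
      (auto simp: code_graph_def code_edges_def workers_def gradients_def symmetric_def sym_def)
qed

text \<open>In a symmetric digraph the out-degree of a vertex is its degree as a graph vertex.\<close>

definition regular :: "('a, 'b) pre_digraph \<Rightarrow> bool" where
  "regular G \<longleftrightarrow> (\<exists>d. \<forall>v \<in> verts G. out_degree G v = d)"

definition neighbors :: "('a, 'b) pre_digraph \<Rightarrow> 'a set \<Rightarrow> 'a set" where
  "neighbors G T = {u \<in> verts G. \<exists>t \<in> T. (t, u) \<in> arcs_ends G}"

definition adversarial_threshold :: "real mat \<Rightarrow> nat \<Rightarrow> nat" where
  "adversarial_threshold E \<eta> =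
     Min ((\<lambda>T. card (neighbors (code_graph E) T)) ` {T. T \<subseteq> gradients E \<and> card T = \<eta>})"

text \<open>
  The adjacency matrix is taken with respect to an enumeration \<open>vs\<close> of the vertices, here the
  workers followed by the gradients; the spectrum does not depend on the enumeration.
\<close>

definition adjacency_matrix :: "('a, 'b) pre_digraph \<Rightarrow> 'a list \<Rightarrow> real mat" where
  "adjacency_matrix G vs =
     mat (length vs) (length vs) (\<lambda>(a, b). if (vs ! a, vs ! b) \<in> arcs_ends G then 1 else 0)"

definition code_vertices :: "real mat \<Rightarrow> vertex list" where
  "code_vertices E = map Worker [0..<dim_col E] @ map Gradient [0..<dim_row E]"

text \<open>
  The real eigenvalues with algebraic multiplicity, in non-increasing order. A real symmetric
  matrix has only real eigenvalues, and for these algebraic and geometric multiplicities agree,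
  so for such a matrix the list is the whole spectrum.
\<close>

definition eigenvalues_desc :: "real mat \<Rightarrow> real list" where
  "eigenvalues_desc A = rev (sorted_list_of_multiset (proots (char_poly A)))"

text \<open>
  The list is indexed from 0, so \<open>\<lambda>\<^sub>k\<close> is entry \<open>k - 1\<close>; this is meaningful for \<open>k\<close> between 1 and
  the number of vertices.
\<close>

definition code_eigenvalue :: "real mat \<Rightarrow> nat \<Rightarrow> real" where
  "code_eigenvalue E k =
     eigenvalues_desc (adjacency_matrix (code_graph E) (code_vertices E)) ! (k - 1)"

end

theory Submission
  imports "HOL-Analysis.Function_Topology" Defs
begin

text \<open>
  Let \<open>S = T \<union> N(T)\<close> with \<open>|T| = \<eta>\<close> and let \<open>n = 2N\<close> be the number of vertices. All edges at \<open>T\<close>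
  stay inside \<open>S\<close>, so \<open>S\<close> spans at least \<open>L\<eta>\<close> edges. Testing the Rayleigh bound for \<open>\<lambda>\<^sub>2\<close> on
  \<open>1\<^sub>S - |S|/n\<close>, which is orthogonal to the constants, gives
  \<open>2L\<eta> - L|S|\<^sup>2/n \<le> \<lambda>\<^sub>2 (|S| - |S|\<^sup>2/n)\<close>. If \<open>|S| \<le> n/2\<close>, this yields \<open>4L\<eta> \<le> (L + \<lambda>\<^sub>2)|S|\<close>, which is the
  claim; otherwise \<open>|N(T)| \<ge> 3\<eta>\<close>, and the ratio is at most 3.

  For the Rayleigh bound itself, the quadratic form attains its maximum \<open>\<mu>\<close> on the unit sphere of
  the orthogonal complement of the constants at an eigenfunction. By connectivity \<open>\<mu> < L\<close>, so \<open>\<mu>\<close>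
  and \<open>L\<close> are distinct roots of the characteristic polynomial and \<open>\<mu> \<le> \<lambda>\<^sub>2\<close>; no spectral theorem
  is needed.
\<close>

text \<open>First-variation principle: for small negative \<open>t\<close> the linear term outweighs
  the quadratic one, so a positive \<open>c\<close> would make the expression negative.\<close>

lemma nonneg_quadratic_linear_coeff:
  fixes c e :: real
  assumes "0 \<le> c" and "\<And>t. 0 \<le> 2 * t * c + t\<^sup>2 * e"
  shows "c = 0"
proof (rule ccontr)
  assume "c \<noteq> 0"
  with assms(1) have "c > 0" by simp
  \<comment> \<open>Any positive \<open>k\<close> above \<open>e\<close> works: at
    \<open>t = - c / k\<close> the value is \<open>(c / k)\<^sup>2 * (e - 2 * k)\<close>.\<close>
  define k where "k = \<bar>e\<bar> + 1"
  have k: "k > 0" "e < k" by (auto simp: k_def)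
  have "2 * (- c / k) * c + (- c / k)\<^sup>2 * e = (c\<^sup>2 / k\<^sup>2) * (e - 2 * k)"
    using k by (simp add: field_simps power2_eq_square)
  also have "\<dots> < 0"
    using k \<open>c > 0\<close> by (intro mult_pos_neg) auto
  finally show False using assms(2)[of "- c / k"] by simp
qed

section \<open>Rayleigh quotients of symmetric weights with constant row sums\<close>

locale symmetric_weights =
  fixes V :: "'a set" and A :: "'a \<Rightarrow> 'a \<Rightarrow> real" and d :: real
  assumes fin: "finite V"
    and sym: "a \<in> V \<Longrightarrow> b \<in> V \<Longrightarrow> A a b = A b a"
    and row_sum: "a \<in> V \<Longrightarrow> (\<Sum>b\<in>V. A a b) = d"
begin

text \<open>Vectors are functions on the whole type of which only the values on \<open>V\<close>
  count, so no enumeration of the vertices is needed here.\<close>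

definition ip :: "('a \<Rightarrow> real) \<Rightarrow> ('a \<Rightarrow> real) \<Rightarrow> real" where
  "ip f g = (\<Sum>a\<in>V. f a * g a)"

definition adj :: "('a \<Rightarrow> real) \<Rightarrow> 'a \<Rightarrow> real" where
  "adj f a = (\<Sum>b\<in>V. A a b * f b)"

lemma ip_commute: "ip f g = ip g f"
  by (simp add: ip_def mult.commute)

lemma ip_add_scaled:
  "ip f (\<lambda>a. g a + t * h a) = ip f g + t * ip f h"
  by (simp add: ip_def algebra_simps sum.distrib sum_distrib_left)

lemma ip_add_scaled_left:
  "ip (\<lambda>a. g a + t * h a) f = ip g f + t * ip h f"
  by (metis ip_add_scaled ip_commute)

lemma adj_add_scaled: "adj (\<lambda>a. g a + t * h a) = (\<lambda>a. adj g a + t * adj h a)"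
  by (rule ext) (simp add: adj_def algebra_simps sum.distrib sum_distrib_left)

lemma ip_adj_commute: "ip f (adj g) = ip g (adj f)"
proof -
  have "ip f (adj g) = (\<Sum>a\<in>V. \<Sum>b\<in>V. f a * (A a b * g b))"
    by (simp add: ip_def adj_def sum_distrib_left)
  also have "\<dots> = (\<Sum>b\<in>V. \<Sum>a\<in>V. f a * (A a b * g b))"
    by (rule sum.swap)
  also have "\<dots> = (\<Sum>b\<in>V. \<Sum>a\<in>V. g b * (A b a * f a))"
    by (intro sum.cong refl) (simp add: sym)
  also have "\<dots> = ip g (adj f)"
    by (simp add: ip_def adj_def sum_distrib_left)
  finally show ?thesis .
qed

lemma adj_one: "a \<in> V \<Longrightarrow> adj (\<lambda>_. 1) a = d"
  by (simp add: adj_def row_sum)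

lemma ip_adj_one: "ip f (adj (\<lambda>_. 1)) = d * ip f (\<lambda>_. 1)"
proof -
  have "ip f (adj (\<lambda>_. 1)) = (\<Sum>a\<in>V. f a * d)"
    unfolding ip_def by (intro sum.cong refl) (simp add: adj_one)
  then show ?thesis
    by (simp add: ip_def sum_distrib_left mult.commute)
qed

lemma ip_self_nonneg: "0 \<le> ip f f"
  by (simp add: ip_def sum_nonneg)

lemma ip_self_eq_0: "ip f f = 0 \<longleftrightarrow> (\<forall>a\<in>V. f a = 0)"
  by (simp add: ip_def sum_nonneg_eq_0_iff fin)

text \<open>A continuous function attains its maximum on a compact set; the two distinct points make
  the unit sphere of the complement of the constants nonempty, and scaling extends the bound from
  the sphere to all \<open>g\<close>.\<close>

lemma Rayleigh_maximiser:
  assumes "a \<in> V" "b \<in> V" "a \<noteq> b"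
  obtains f where "ip f f = 1" "ip f (\<lambda>_. 1) = 0"
    and "\<And>g. ip g (\<lambda>_. 1) = 0 \<Longrightarrow> ip g (adj g) \<le> ip f (adj f) * ip g g"
proof -
  \<comment> \<open>Pinning the values off \<open>V\<close> to 0 makes the box a product of compact
    sets, hence compact by Tychonoff. The interval \<open>{-1..1}\<close> loses nothing, since a
    unit function has no larger values on \<open>V\<close>.\<close>
  define box :: "('a \<Rightarrow> real) set" where
    "box = PiE UNIV (\<lambda>c. if c \<in> V then {-1..1} else {0})"
  define K where "K = box \<inter> ({f. ip f f = 1} \<inter> {f. ip f (\<lambda>_. 1) = 0})"
  have "compactin euclidean box"
    unfolding box_def by (simp add: compactin_PiE flip: euclidean_product_topology)
  then have "compact box" by simp
  moreover have "closed {f. ip f f = 1}" "closed {f. ip f (\<lambda>_. 1) = 0}"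
    unfolding ip_def by (intro closed_Collect_eq continuous_intros continuous_on_product_coordinates)+
  ultimately have "compact K"
    unfolding K_def by (intro compact_Int_closed closed_Int)
  have in_K: "(\<lambda>c. if c \<in> V then g c / sqrt (ip g g) else 0) \<in> K"
    if g0: "ip g (\<lambda>_. 1) = 0" and pos: "ip g g > 0" for g
  proof -
    define h where "h = (\<lambda>c. if c \<in> V then g c / sqrt (ip g g) else 0)"
    have "ip h h = (\<Sum>c\<in>V. g c * g c / ip g g)"
      unfolding ip_def[of h] using pos by (intro sum.cong refl) (auto simp: h_def)
    then have hh: "ip h h = 1"
      using pos by (simp add: ip_def flip: sum_divide_distrib)
    have "ip h (\<lambda>_. 1) = (\<Sum>c\<in>V. g c * 1 / sqrt (ip g g))"
      unfolding ip_def[of h] by (intro sum.cong refl) (auto simp: h_def)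
    then have h0: "ip h (\<lambda>_. 1) = 0"
      using g0 by (simp add: ip_def flip: sum_divide_distrib)
    have "h c \<in> {-1..1}" if "c \<in> V" for c
    proof -
      have "h c * h c \<le> ip h h"
        unfolding ip_def using that fin by (intro member_le_sum) auto
      then show ?thesis
        using hh abs_le_square_iff[of "h c" 1] by (simp add: power2_eq_square abs_le_iff)
    qed
    moreover have "h c = 0" if "c \<notin> V" for c
      using that by (simp add: h_def)
    ultimately have "h \<in> box"
      by (simp add: box_def PiE_iff)
    then show ?thesis
      using hh h0 by (simp add: K_def flip: h_def)
  qed
  have "K \<noteq> {}"
  proof -
    define g where "g c = (if c = a then 1 else if c = b then -1 else 0 :: real)" for c
    have g_split: "g c = (if c = a then 1 else 0) - (if c = b then 1 else 0)" for c
      using assms by (auto simp: g_def)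
    have "ip g (\<lambda>_. 1) = 0"
      using assms by (simp add: ip_def g_split sum_subtractf fin)
    moreover have "ip g g \<noteq> 0"
      using assms by (auto simp: ip_self_eq_0 g_def)
    ultimately show ?thesis
      using in_K[of g] ip_self_nonneg[of g] by auto
  qed
  moreover have "continuous_on K (\<lambda>f. ip f (adj f))"
    unfolding ip_def adj_def
    by (intro continuous_intros continuous_on_subset[OF continuous_on_product_coordinates]) auto
  ultimately obtain f where f: "f \<in> K" and max: "\<And>g. g \<in> K \<Longrightarrow> ip g (adj g) \<le> ip f (adj f)"
    using continuous_attains_sup[OF \<open>compact K\<close>] by metis
  show thesis
  proof
    show "ip f f = 1" "ip f (\<lambda>_. 1) = 0" using f by (auto simp: K_def)
    fix g assume g0: "ip g (\<lambda>_. 1) = 0"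
    show "ip g (adj g) \<le> ip f (adj f) * ip g g"
    proof (cases "ip g g = 0")
      case True
      then have "\<forall>c\<in>V. g c = 0" by (simp add: ip_self_eq_0)
      then show ?thesis using True by (simp add: ip_def)
    next
      case False
      then have pos: "ip g g > 0" using ip_self_nonneg[of g] by simp
      define h where "h = (\<lambda>c. if c \<in> V then g c / sqrt (ip g g) else 0)"
      have "ip h (adj h) = (\<Sum>c\<in>V. \<Sum>e\<in>V. (g c / sqrt (ip g g)) * (A c e * (g e / sqrt (ip g g))))"
        unfolding ip_def[of h] adj_def sum_distrib_left by (intro sum.cong refl) (auto simp: h_def)
      also have "\<dots> = (\<Sum>c\<in>V. \<Sum>e\<in>V. g c * (A c e * g e) / ip g g)"
        using pos by (intro sum.cong refl) (simp add: field_simps)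
      also have "\<dots> = ip g (adj g) / ip g g"
        by (simp add: ip_def[of g "adj g"] adj_def sum_distrib_left flip: sum_divide_distrib)
      finally have "ip g (adj g) / ip g g \<le> ip f (adj f)"
        using max[OF in_K[OF g0 pos]] by (simp add: h_def)
      then show ?thesis using pos by (simp add: field_simps)
    qed
  qed
qed

text \<open>The maximiser \<open>f\<close> is perturbed along its residual
  \<open>r = adj f - \<mu> f\<close>. This is admissible: \<open>adj\<close> is self-adjoint and has
  the constants as eigenfunctions, so \<open>r\<close> is again orthogonal to them. Maximality then
  forces \<open>ip r r = 0\<close>.\<close>

lemma Rayleigh_eigenfunction:
  assumes "a \<in> V" "b \<in> V" "a \<noteq> b"
  obtains f \<mu> where "ip f f = 1" "ip f (\<lambda>_. 1) = 0"
    and "\<And>c. c \<in> V \<Longrightarrow> adj f c = \<mu> * f c"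
    and "\<And>g. ip g (\<lambda>_. 1) = 0 \<Longrightarrow> ip g (adj g) \<le> \<mu> * ip g g"
proof -
  obtain f where ff: "ip f f = 1" and f0: "ip f (\<lambda>_. 1) = 0"
    and max: "\<And>g. ip g (\<lambda>_. 1) = 0 \<Longrightarrow> ip g (adj g) \<le> ip f (adj f) * ip g g"
    using Rayleigh_maximiser[OF assms] by blast
  define \<mu> where "\<mu> = ip f (adj f)"
  define r where "r = (\<lambda>c. adj f c + (- \<mu>) * f c)"
  have r0: "ip r (\<lambda>_. 1) = 0"
    using f0 unfolding r_def ip_add_scaled_left
    by (simp add: ip_commute[of "adj f"] ip_adj_commute[of "\<lambda>_. 1"] ip_adj_one)
  have "ip r r = 0"
  proof (rule nonneg_quadratic_linear_coeff[OF ip_self_nonneg])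
    fix t :: real
    have rf: "ip r (adj f) = ip r r + \<mu> * ip r f"
    proof -
      have "ip r r = ip r (\<lambda>c. adj f c + (- \<mu>) * f c)" by (simp add: r_def)
      then show ?thesis by (simp only: ip_add_scaled)
    qed
    \<comment> \<open>The minus sign makes the linear coefficient of
      \<open>\<mu> * ip g g - ip g (adj g)\<close> equal to \<open>+ 2 * ip r r\<close>, the shape
      that the quadratic lemma expects.\<close>
    define g where "g = (\<lambda>c. f c + (- t) * r c)"
    have "ip g (\<lambda>_. 1) = 0"
      unfolding g_def ip_add_scaled_left by (simp add: f0 r0)
    then have "ip g (adj g) \<le> \<mu> * ip g g"
      using max by (simp add: \<mu>_def)
    moreover have "ip g g = 1 - 2 * t * ip r f + t\<^sup>2 * ip r r"
      unfolding g_def ip_add_scaled ip_add_scaled_left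
      by (simp add: ff ip_commute[of f r] algebra_simps power2_eq_square)
    moreover have "ip g (adj g) = \<mu> - 2 * t * ip r (adj f) + t\<^sup>2 * ip r (adj r)"
      unfolding g_def adj_add_scaled ip_add_scaled ip_add_scaled_left
      by (simp add: ip_adj_commute[of f r] \<mu>_def algebra_simps power2_eq_square)
    ultimately show "0 \<le> 2 * t * ip r r + t\<^sup>2 * (\<mu> * ip r r - ip r (adj r))"
      by (simp add: rf algebra_simps)
  qed
  then have "\<And>c. c \<in> V \<Longrightarrow> adj f c = \<mu> * f c"
    by (simp add: ip_self_eq_0 r_def)
  with ff f0 max show thesis
    using that[of f \<mu>] by (simp add: \<mu>_def)
qed


text \<open>Expanding the square, row sums and symmetry turn each square term into
  \<open>d * ip f f\<close>. It writes the gap between \<open>d\<close> and the Rayleigh quotient as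
  a sum over edges.\<close>

lemma Dirichlet_form:
  "(\<Sum>a\<in>V. \<Sum>b\<in>V. A a b * (f a - f b)\<^sup>2) = 2 * (d * ip f f - ip f (adj f))"
proof -
  have "(\<Sum>a\<in>V. \<Sum>b\<in>V. A a b * (f a - f b)\<^sup>2) =
      (\<Sum>a\<in>V. \<Sum>b\<in>V. A a b * (f a)\<^sup>2) + (\<Sum>a\<in>V. \<Sum>b\<in>V. A a b * (f b)\<^sup>2)
        - 2 * (\<Sum>a\<in>V. \<Sum>b\<in>V. f a * (A a b * f b))"
    by (simp add: sum_distrib_left power2_diff algebra_simps sum.distrib sum_subtractf)
  also have "(\<Sum>a\<in>V. \<Sum>b\<in>V. A a b * (f b)\<^sup>2) = (\<Sum>b\<in>V. \<Sum>a\<in>V. A b a * (f b)\<^sup>2)"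
    by (subst sum.swap) (intro sum.cong refl, simp add: sym)
  also have "(\<Sum>a\<in>V. \<Sum>b\<in>V. A a b * (f a)\<^sup>2) = d * ip f f"
    by (simp add: row_sum ip_def sum_distrib_left power2_eq_square flip: sum_distrib_right)
  also have "(\<Sum>a\<in>V. \<Sum>b\<in>V. f a * (A a b * f b)) = ip f (adj f)"
    by (simp add: ip_def adj_def sum_distrib_left)
  finally show ?thesis by simp
qed

text \<open>If \<open>\<mu> \<ge> d\<close>, the Dirichlet sum vanishes term by term, so
  \<open>f\<close> is constant along edges and, by connectivity, on \<open>V\<close>. Being
  orthogonal to the constants it is then 0, against its unit norm.\<close>

lemma eigenvalue_less_row_sum:
  assumes nonneg: "\<And>a b. 0 \<le> A a b"
    and connected: "\<And>a b. a \<in> V \<Longrightarrow> b \<in> V \<Longrightarrow> (a, b) \<in> {(a, b). a \<in> V \<and> b \<in> V \<and> A a b \<noteq> 0}\<^sup>*"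
    and ff: "ip f f = 1" and f0: "ip f (\<lambda>_. 1) = 0"
    and eig: "\<And>c. c \<in> V \<Longrightarrow> adj f c = \<mu> * f c"
  shows "\<mu> < d"
proof (rule ccontr)
  assume "\<not> \<mu> < d"
  have "ip f (adj f) = \<mu> * ip f f"
    unfolding ip_def by (simp add: eig sum_distrib_left mult_ac)
  with \<open>\<not> \<mu> < d\<close> have "(\<Sum>a\<in>V. \<Sum>b\<in>V. A a b * (f a - f b)\<^sup>2) \<le> 0"
    by (simp add: Dirichlet_form ff)
  moreover have "0 \<le> (\<Sum>a\<in>V. \<Sum>b\<in>V. A a b * (f a - f b)\<^sup>2)"
    by (intro sum_nonneg mult_nonneg_nonneg nonneg) auto
  ultimately have "(\<Sum>a\<in>V. \<Sum>b\<in>V. A a b * (f a - f b)\<^sup>2) = 0"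
    by simp
  then have eq: "f a = f b" if "a \<in> V" "b \<in> V" "A a b \<noteq> 0" for a b
    using that by (auto simp: sum_nonneg_eq_0_iff fin nonneg sum_nonneg)
  have const: "f a = f b" if "a \<in> V" "b \<in> V" for a b
    using connected[OF that] by (induction rule: rtrancl_induct) (auto dest: eq)
  have "f a = 0" if "a \<in> V" for a
  proof -
    have "ip f (\<lambda>_. 1) = (\<Sum>b\<in>V. f a)"
      unfolding ip_def by (intro sum.cong refl, simp, rule const[OF _ that])
    then show ?thesis using f0 that fin by auto
  qed
  then show False using ff by (simp add: ip_def)
qed

text \<open>The difference of the indicators of two nonadjacent, loop-free vertices has quadratic
  form 0 and norm square 2. The sign is what later allows multiplying and dividing by
  \<open>d + \<Lambda>\<close>.\<close>

lemma Rayleigh_bound_nonneg: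
  assumes "a \<in> V" "b \<in> V" "a \<noteq> b" and "A a a = 0" "A b b = 0" "A a b = 0"
    and bound: "\<And>g. ip g (\<lambda>_. 1) = 0 \<Longrightarrow> ip g (adj g) \<le> \<mu> * ip g g"
  shows "0 \<le> \<mu>"
proof -
  define g where "g c = (if c = a then 1 else 0) - (if c = b then 1 else 0 :: real)" for c
  have ip_g: "ip g h = h a - h b" for h
    using assms(1,2) fin by (simp add: ip_def g_def left_diff_distrib sum_subtractf if_distrib[of "\<lambda>x. x * _"] cong: if_cong)
  have adj_g: "adj g c = A c a - A c b" for c
    using assms(1,2) fin by (simp add: adj_def g_def right_diff_distrib sum_subtractf if_distrib[of "\<lambda>x. _ * x"] cong: if_cong)
  have "ip g g = 2"
    using \<open>a \<noteq> b\<close> by (simp add: ip_g) (simp add: g_def)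
  moreover have "A b a = 0" using assms sym by simp
  ultimately show ?thesis
    using bound[of g] assms(4-6) by (simp add: ip_g adj_g)
qed

text \<open>\<open>M\<close> plays the role of the neighbourhood of \<open>T\<close>, and
  \<open>\<Lambda>\<close> is any nonnegative Rayleigh bound, possibly above \<open>d\<close>. With
  \<open>card V = 2 * N\<close> the size condition reads \<open>card T \<le> N / 4\<close>.\<close>

lemma expansion_of_Rayleigh_bound:
  assumes "T \<subseteq> V" "M \<subseteq> V" "T \<inter> M = {}"
    and nonneg: "\<And>a b. 0 \<le> A a b"
    and nbrs: "\<And>a b. a \<in> T \<Longrightarrow> b \<in> V \<Longrightarrow> b \<notin> M \<Longrightarrow> A a b = 0"
    and bound: "\<And>g. ip g (\<lambda>_. 1) = 0 \<Longrightarrow> ip g (adj g) \<le> \<Lambda> * ip g g"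
    and "0 \<le> \<Lambda>" "0 < d" and small: "8 * card T \<le> card V"
  shows "(3 * d - \<Lambda>) * card T \<le> (d + \<Lambda>) * card M"
proof -
  define m where "m = real (card M)"
  define t where "t = real (card T)"
  define n where "n = real (card V)"
  define S where "S = T \<union> M"
  define s where "s = t + m"
  have finTM: "finite T" "finite M"
    using assms(1,2) fin finite_subset by blast+
  have "S \<subseteq> V" using assms by (auto simp: S_def)
  have card_S: "real (card S) = s"
    using finTM assms(3) by (simp add: S_def s_def t_def m_def card_Un_disjoint)
  have row_T: "(\<Sum>b\<in>M. A a b) = d" if "a \<in> T" for a
  proof -
    have "(\<Sum>b\<in>M. A a b) = (\<Sum>b\<in>V. A a b)"
      using assms(2) that by (intro sum.mono_neutral_left) (auto simp: fin nbrs)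
    then show ?thesis using row_sum that assms(1) by auto
  qed
  \<comment> \<open>Double counting of the weight between \<open>T\<close> and \<open>M\<close>: it
    is \<open>d * t\<close> seen from \<open>T\<close> and at most \<open>d * m\<close> seen from
    \<open>M\<close>, whence \<open>t \<le> m\<close>.\<close>
  have "(\<Sum>b\<in>M. \<Sum>a\<in>T. A b a) = (\<Sum>a\<in>T. \<Sum>b\<in>M. A b a)"
    by (rule sum.swap)
  also have "\<dots> = (\<Sum>a\<in>T. \<Sum>b\<in>M. A a b)"
    using assms(1,2) sym by (intro sum.cong refl) blast
  also have "\<dots> = d * t"
    by (simp add: row_T t_def)
  finally have col_T: "(\<Sum>b\<in>M. \<Sum>a\<in>T. A b a) = d * t" .
  have "(\<Sum>b\<in>M. \<Sum>a\<in>T. A b a) \<le> (\<Sum>b\<in>M. \<Sum>a\<in>V. A b a)"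
    using assms(1,2) nonneg fin by (intro sum_mono sum_mono2) auto
  also have "\<dots> = (\<Sum>b\<in>M. d)"
    using assms(2) row_sum by (intro sum.cong refl) blast
  finally have "t \<le> m"
    using \<open>0 < d\<close> by (simp add: col_T m_def)

  \<comment> \<open>\<open>c\<close> is the mean of \<open>\<chi>\<close> over \<open>V\<close>, so
    \<open>\<chi> - c\<close> is orthogonal to the constants.\<close>
  define c where "c = s / n"
  define \<chi> where "\<chi> a = (if a \<in> S then 1 else 0 :: real)" for a
  have ip_\<chi>: "ip \<chi> f = (\<Sum>a\<in>S. f a)" for f
    unfolding ip_def \<chi>_def using \<open>S \<subseteq> V\<close> fin
    by (simp add: if_distrib[of "\<lambda>x. x * _"] sum.If_cases Int_absorb1 cong: if_cong)
  have adj_\<chi>: "adj \<chi> a = (\<Sum>b\<in>S. A a b)" for a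
    unfolding adj_def \<chi>_def using \<open>S \<subseteq> V\<close> fin
    by (simp add: if_distrib[of "\<lambda>x. _ * x"] sum.If_cases Int_absorb1 cong: if_cong)
  have \<chi>1: "ip \<chi> (\<lambda>_. 1) = s" "ip \<chi> \<chi> = s"
    by (simp_all add: ip_\<chi> card_S) (simp add: \<chi>_def card_S)
  \<comment> \<open>The form sums over ordered pairs, so the weight \<open>d * t\<close> between
    \<open>T\<close> and \<open>M\<close> counts once in each direction.\<close>
  have inner_edges: "2 * d * t \<le> ip \<chi> (adj \<chi>)"
  proof -
    have "d * t = (\<Sum>a\<in>T. \<Sum>b\<in>M. A a b)"
      by (simp add: row_T t_def)
    also have "\<dots> \<le> (\<Sum>a\<in>T. \<Sum>b\<in>S. A a b)"
      using nonneg finTM by (intro sum_mono sum_mono2) (auto simp: S_def)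
    finally have 1: "d * t \<le> (\<Sum>a\<in>T. \<Sum>b\<in>S. A a b)" .
    have "d * t \<le> (\<Sum>a\<in>M. \<Sum>b\<in>S. A a b)"
      unfolding col_T[symmetric]
      using nonneg finTM by (intro sum_mono sum_mono2) (auto simp: S_def)
    moreover have "(\<Sum>a\<in>S. \<Sum>b\<in>S. A a b) = (\<Sum>a\<in>T. \<Sum>b\<in>S. A a b) + (\<Sum>a\<in>M. \<Sum>b\<in>S. A a b)"
      unfolding S_def using finTM assms(3) by (simp add: sum.union_disjoint)
    ultimately show ?thesis using 1 by (simp add: ip_\<chi> adj_\<chi>)
  qed
  show ?thesis
  proof (cases "t = 0")
    case True
    then show ?thesis using \<open>0 \<le> \<Lambda>\<close> \<open>0 < d\<close> by (simp add: t_def)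
  next
    case False
    then have "t > 0" by (simp add: t_def)
    then have "n > 0" using small by (simp add: t_def n_def)
    have n8: "8 * t \<le> n" using small by (simp add: t_def n_def)
    have ip_1: "ip (\<lambda>_. 1) (\<lambda>_. 1) = n" by (simp add: ip_def n_def)
    \<comment> \<open>The factor 1 gives \<open>g\<close> the shape required by
      \<open>ip_add_scaled\<close> and \<open>adj_add_scaled\<close>.\<close>
    define g where "g = (\<lambda>a. \<chi> a + (- c) * 1)"
    have "ip g (\<lambda>_. 1) = 0"
      unfolding g_def ip_add_scaled_left using \<open>n > 0\<close> by (simp add: \<chi>1 ip_1 c_def)
    then have "ip g (adj g) \<le> \<Lambda> * ip g g"
      by (rule bound)
    moreover have "ip g g = s - s\<^sup>2 / n"
      unfolding g_def ip_add_scaled ip_add_scaled_left using \<open>n > 0\<close>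
      by (simp add: \<chi>1 ip_1 ip_commute[of "\<lambda>_. 1" \<chi>] c_def field_simps power2_eq_square)
    moreover have "ip g (adj g) = ip \<chi> (adj \<chi>) - d * s\<^sup>2 / n"
      unfolding g_def adj_add_scaled ip_add_scaled ip_add_scaled_left using \<open>n > 0\<close>
      by (simp add: \<chi>1 ip_1 ip_adj_one ip_adj_commute[of "\<lambda>_. 1" \<chi>] c_def field_simps power2_eq_square)
    ultimately have main: "2 * d * t - d * s\<^sup>2 / n \<le> \<Lambda> * (s - s\<^sup>2 / n)"
      using inner_edges by simp
    have "(3 * d - \<Lambda>) * t \<le> (d + \<Lambda>) * m"
    \<comment> \<open>No upper bound on \<open>\<Lambda>\<close> is available. If
      \<open>d \<le> \<Lambda>\<close>, then \<open>3 * d - \<Lambda> \<le> d + \<Lambda>\<close>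
      and \<open>t \<le> m\<close> suffices; otherwise \<open>d - \<Lambda>\<close> is a positive
      factor.\<close>
    proof (cases "d \<le> \<Lambda>")
      case True
      have "(3 * d - \<Lambda>) * t \<le> (d + \<Lambda>) * t"
        using True \<open>t > 0\<close> by (intro mult_right_mono) auto
      also have "\<dots> \<le> (d + \<Lambda>) * m"
        using \<open>t \<le> m\<close> \<open>0 < d\<close> \<open>0 \<le> \<Lambda>\<close> by (intro mult_left_mono) auto
      finally show ?thesis .
    next
      case small_eig: False
      show ?thesis
      proof (cases "2 * s \<le> n")
        case True
        define q where "q = s\<^sup>2 / n"
        have "s * (2 * s) \<le> s * n"
          using True \<open>t > 0\<close> by (intro mult_left_mono) (auto simp: s_def m_def)
        then have "2 * q \<le> s"
          using \<open>n > 0\<close> by (simp add: q_def field_simps power2_eq_square)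
        then have "(d - \<Lambda>) * (2 * q) \<le> (d - \<Lambda>) * s"
          using small_eig by (intro mult_left_mono) auto
        moreover have "2 * d * t - d * q \<le> \<Lambda> * (s - q)"
          using main by (simp add: q_def)
        ultimately have "4 * d * t \<le> (d + \<Lambda>) * s"
          by (simp add: algebra_simps)
        then show ?thesis by (simp add: s_def algebra_simps)
      next
        \<comment> \<open>Here \<open>s > n / 2 \<ge> 4 * t\<close>, and
          \<open>m = s - t\<close>.\<close>
        case False
        then have "3 * t \<le> m" using n8 by (simp add: s_def)
        have "(3 * d - \<Lambda>) * t \<le> (d + \<Lambda>) * (3 * t)"
          using \<open>0 \<le> \<Lambda>\<close> \<open>t > 0\<close> by (simp add: algebra_simps)
        also have "\<dots> \<le> (d + \<Lambda>) * m"
          using \<open>3 * t \<le> m\<close> \<open>0 < d\<close> \<open>0 \<le> \<Lambda>\<close> by (intro mult_left_mono) auto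
        finally show ?thesis .
      qed
    qed
    then show ?thesis by (simp add: t_def m_def)
  qed
qed

end

section \<open>From eigenfunctions to the sorted spectrum\<close>

lemma second_eigenvalue_ge:
  fixes B :: "real mat"
  assumes B: "B \<in> carrier_mat n n" and "eigenvalue B x" "eigenvalue B y" and "x < y"
  shows "x \<le> eigenvalues_desc B ! 1"
proof -
  define xs where "xs = eigenvalues_desc B"
  have "char_poly B \<noteq> 0"
    using degree_monic_char_poly[OF B] by auto
  then have "set xs = {z. eigenvalue B z}"
    using B by (auto simp: xs_def eigenvalues_desc_def eigenvalue_root_char_poly)
  then have "x \<in> set xs" "y \<in> set xs" using assms by auto
  then obtain i j where ij: "i < length xs" "xs ! i = x" "j < length xs" "xs ! j = y"
    by (meson in_set_conv_nth)
  have desc: "sorted_wrt (\<ge>) xs"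
    by (simp add: xs_def eigenvalues_desc_def sorted_wrt_rev)
  have anti: "xs ! l \<le> xs ! k" if "k \<le> l" "l < length xs" for k l
    using that desc by (cases "k = l") (auto simp: sorted_wrt_iff_nth_less)
  \<comment> \<open>The head of the list is at least \<open>y > x\<close>, so \<open>x\<close> sits
    at index 1 or later; in particular index 1, the second largest eigenvalue, lies within the
    list.\<close>
  have "i \<noteq> 0"
    using anti[of 0 j] ij \<open>x < y\<close> by (intro notI) auto
  then show ?thesis
    using anti[of 1 i] ij by (simp add: xs_def)
qed

text \<open>The eigenvector lists the values of \<open>f\<close> along \<open>vs\<close>;
  distinctness of \<open>vs\<close> turns sums over indices into sums over vertices.\<close>

lemma eigenvalue_adjacency_matrix:
  assumes "distinct vs" and "set vs = verts G"
    and "c0 \<in> verts G" "f c0 \<noteq> 0"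
    and eig: "\<And>a. a \<in> verts G \<Longrightarrow>
        (\<Sum>b\<in>verts G. (if (a, b) \<in> arcs_ends G then 1 else 0) * f b) = \<mu> * f a"
  shows "eigenvalue (adjacency_matrix G vs) \<mu>"
proof -
  let ?n = "length vs"
  define v where "v = vec ?n (\<lambda>k. f (vs ! k))"
  obtain k where k: "k < ?n" "vs ! k = c0"
    using assms by (metis in_set_conv_nth)
  have "v \<noteq> 0\<^sub>v ?n"
    using k assms(4) by (metis index_vec index_zero_vec(1) v_def)
  moreover have "adjacency_matrix G vs *\<^sub>v v = \<mu> \<cdot>\<^sub>v v"
  proof (rule eq_vecI)
    fix i assume "i < dim_vec (\<mu> \<cdot>\<^sub>v v)"
    then have i: "i < ?n" by (simp add: v_def)
    have "(adjacency_matrix G vs *\<^sub>v v) $ i =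
        (\<Sum>k<?n. (if (vs ! i, vs ! k) \<in> arcs_ends G then 1 else 0) * f (vs ! k))"
      using i by (simp add: adjacency_matrix_def v_def scalar_prod_def atLeast0LessThan)
    also have "\<dots> = (\<Sum>b\<in>set vs. (if (vs ! i, b) \<in> arcs_ends G then 1 else 0) * f b)"
      using sum.reindex_bij_betw[OF bij_betw_nth[OF assms(1) refl refl],
          of "\<lambda>b. (if (vs ! i, b) \<in> arcs_ends G then 1 else 0) * f b"] by simp
    also have "\<dots> = \<mu> * f (vs ! i)"
      using eig[of "vs ! i"] i assms(2) nth_mem[OF i] by simp
    finally show "(adjacency_matrix G vs *\<^sub>v v) $ i = (\<mu> \<cdot>\<^sub>v v) $ i"
      using i by (simp add: v_def)
  qed (simp add: adjacency_matrix_def v_def)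
  ultimately show ?thesis
    by (auto simp: eigenvalue_def eigenvector_def adjacency_matrix_def v_def intro!: exI[of _ v])
qed

lemma out_degree_eq_sum:
  assumes "pair_graph G" "a \<in> pverts G"
  shows "real (out_degree G a) = (\<Sum>b\<in>pverts G. if (a, b) \<in> parcs G then 1 else 0)"
proof -
  interpret pair_graph G by fact
  have "out_arcs (with_proj G) a = Pair a ` {b \<in> pverts G. (a, b) \<in> parcs G}"
    by (auto simp: out_arcs_def dest: in_arcsD2)
  then have "out_degree G a = card {b \<in> pverts G. (a, b) \<in> parcs G}"
    by (simp add: out_degree_def card_image inj_on_def)
  then show ?thesis
    by (simp flip: sum.inter_filter)
qed

lemma code_graph_degree:
  assumes "i < dim_col E"
  shows "out_degree (code_graph E) (Worker i) = card {j. j < dim_row E \<and> E $$ (j, i) \<noteq> 0}"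
proof -
  have "out_arcs (code_graph E) (Worker i) =
      (\<lambda>j. (Worker i, Gradient j)) ` {j. j < dim_row E \<and> E $$ (j, i) \<noteq> 0}"
    using assms by (auto simp: out_arcs_def code_graph_def code_edges_def)
  then show ?thesis
    by (simp add: out_degree_def card_image inj_on_def)
qed

section \<open>Expansion of the code graph and the adversarial threshold\<close>

theorem proposition1:
  fixes E :: "real mat" and N K L \<eta> :: nat
  assumes "E \<in> carrier_mat K N"
    and "N = K"
    and "L = computation_load E"
    and "Digraph_Component.connected (code_graph E)"
    and "regular (code_graph E)"
    and "0 < \<eta>" and "real \<eta> \<le> real N / 4"
  shows "real (adversarial_threshold E \<eta>)
           \<ge> ((3 * real L - code_eigenvalue E 2) / (real L + code_eigenvalue E 2)) * real \<eta>"
proof -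
  define G where "G = code_graph E"
  define V where "V = pverts G"
  define A :: "vertex \<Rightarrow> vertex \<Rightarrow> real" where "A a b = (if (a, b) \<in> parcs G then 1 else 0)" for a b
  interpret G: pair_graph G
    unfolding G_def by (rule pair_graph_code_graph)
  have dims: "dim_row E = N" "dim_col E = N" using assms(1,2) by auto
  have "N \<ge> 4" using assms(6,7) by linarith

  obtain d where d: "\<And>v. v \<in> V \<Longrightarrow> out_degree G v = d"
    using assms(5) by (auto simp: regular_def V_def G_def)
  \<comment> \<open>Regularity gives every column the same number of nonzero entries, so the maximum
    defining \<open>L\<close> ranges over \<open>{d}\<close>.\<close>
  have "L = d"
  proof -
    have "card {j. j < N \<and> E $$ (j, i) \<noteq> 0} = d" if "i < N" for i
      using d[of "Worker i"] code_graph_degree[of i E] that dims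
      by (simp add: V_def G_def code_graph_def workers_def)
    then have "(\<lambda>i. card {j. j < N \<and> E $$ (j, i) \<noteq> 0}) ` {..<N} = {d}"
      using \<open>N \<ge> 4\<close> by (auto simp: image_iff intro!: exI[of _ 0] image_eqI[of _ _ 0])
    then show ?thesis using assms(3) by (simp add: computation_load_def dims)
  qed

  have sym: "(a, b) \<in> parcs G \<longleftrightarrow> (b, a) \<in> parcs G" for a b
    by (auto simp: G_def code_graph_def)
  interpret W: symmetric_weights V A "real L"
  proof
    show "finite V" by (simp add: V_def)
    show "A a b = A b a" for a b using sym by (simp add: A_def)
    show "(\<Sum>b\<in>V. A a b) = real L" if "a \<in> V" for a
      using out_degree_eq_sum[of G a] that d[OF that] G.pair_graph_axioms
      by (simp add: \<open>L = d\<close> A_def V_def)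
  qed

  have V_eq: "V = workers E \<union> gradients E" by (simp add: V_def G_def code_graph_def)
  \<comment> \<open>Two distinct gradients are never adjacent, by bipartiteness; they serve both as
    the two points of the Rayleigh argument and as the test pair for
    \<open>0 \<le> \<mu>\<close>.\<close>
  have grads: "Gradient 0 \<in> V" "Gradient 1 \<in> V"
    using \<open>N \<ge> 4\<close> by (auto simp: V_eq gradients_def dims)
  have no_arc: "(Gradient i, Gradient j) \<notin> parcs G" for i j
    by (auto simp: G_def code_graph_def code_edges_def)
  have "card V = 2 * N"
  proof -
    have "card (workers E) = N" "card (gradients E) = N" "workers E \<inter> gradients E = {}"
      by (auto simp: workers_def gradients_def dims card_image inj_on_def)
    then show ?thesis by (simp add: V_eq card_Un_disjoint workers_def gradients_def)
  qed

  obtain f \<mu> where f: "W.ip f f = 1" "W.ip f (\<lambda>_. 1) = 0"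
    and eig: "\<And>c. c \<in> V \<Longrightarrow> W.adj f c = \<mu> * f c"
    and bound: "\<And>g. W.ip g (\<lambda>_. 1) = 0 \<Longrightarrow> W.ip g (W.adj g) \<le> \<mu> * W.ip g g"
    using W.Rayleigh_eigenfunction[OF grads] by auto
  have "0 \<le> \<mu>"
    by (rule W.Rayleigh_bound_nonneg[OF grads _ _ _ _ bound]) (simp_all add: A_def no_arc)
  have "\<mu> < real L"
  proof (rule W.eigenvalue_less_row_sum[OF _ _ f eig])
    fix a b assume "a \<in> V" "b \<in> V"
    \<comment> \<open>\<open>connected\<close> speaks of the symmetrised digraph; as the arcs are
      already symmetric, it yields directed paths in \<open>G\<close> itself.\<close>
    moreover have "strongly_connected G"
      using G.symmetric_connected_imp_strongly_connected assms(4) G.sym_arcs by (simp add: G_def)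
    ultimately have "(a, b) \<in> rtrancl_on V (parcs G)"
      by (auto simp: strongly_connected_def reachable_def V_def)
    then have "(a, b) \<in> (parcs G)\<^sup>*"
      by (simp add: rtrancl_on_rtranclI)
    moreover have "parcs G \<subseteq> {(a, b). a \<in> V \<and> b \<in> V \<and> A a b \<noteq> 0}"
      by (auto simp: A_def V_def dest: G.in_arcsD1 G.in_arcsD2)
    ultimately show "(a, b) \<in> {(a, b). a \<in> V \<and> b \<in> V \<and> A a b \<noteq> 0}\<^sup>*"
      using rtrancl_mono by blast
  qed (simp_all add: A_def)

  define \<Lambda> where "\<Lambda> = code_eigenvalue E 2"
  have "\<mu> \<le> \<Lambda>"
  proof -
    let ?B = "adjacency_matrix G (code_vertices E)"
    have vs: "distinct (code_vertices E)" "set (code_vertices E) = verts G"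
      using V_eq by (auto simp: code_vertices_def distinct_map inj_on_def workers_def gradients_def
          V_def atLeast0LessThan)
    have "\<exists>c\<in>V. f c \<noteq> 0" using f(1) by (auto simp: W.ip_def intro: ccontr)
    then have "eigenvalue ?B \<mu>"
      using eigenvalue_adjacency_matrix[OF vs, of _ f \<mu>] eig[unfolded W.adj_def A_def]
      by (auto simp: V_def)
    moreover have "eigenvalue ?B (real L)"
      using eigenvalue_adjacency_matrix[OF vs, of _ "\<lambda>_. 1" "real L"] grads
        W.adj_one[unfolded W.adj_def A_def]
      by (auto simp: V_def)
    moreover have "?B \<in> carrier_mat (length (code_vertices E)) (length (code_vertices E))"
      by (simp add: adjacency_matrix_def)
    ultimately show ?thesis
      using second_eigenvalue_ge \<open>\<mu> < real L\<close> by (simp add: \<Lambda>_def code_eigenvalue_def G_def)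
  qed
  \<comment> \<open>Raising \<open>\<mu>\<close> to \<open>\<Lambda>\<close> keeps the bound because
    \<open>ip g g\<close> is nonnegative.\<close>
  have bound': "W.ip g (W.adj g) \<le> \<Lambda> * W.ip g g" if "W.ip g (\<lambda>_. 1) = 0" for g
    using bound[OF that] mult_right_mono[OF \<open>\<mu> \<le> \<Lambda>\<close> W.ip_self_nonneg[of g]] by linarith

  have expansion: "(3 * real L - \<Lambda>) * real \<eta> \<le> (real L + \<Lambda>) * real (card (neighbors G T))"
    if T: "T \<subseteq> gradients E" "card T = \<eta>" for T
    unfolding T(2)[symmetric]
  proof (rule W.expansion_of_Rayleigh_bound)
    show "T \<subseteq> V"
      using T by (auto simp: V_eq)
    show "neighbors G T \<subseteq> V"
      by (auto simp: neighbors_def V_def)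
    have "(a, b) \<notin> parcs G" if "a \<in> gradients E" "b \<in> gradients E" for a b
      using that no_arc by (auto simp: gradients_def)
    then show "T \<inter> neighbors G T = {}"
      using T by (auto simp: neighbors_def)
    show "A a b = 0" if "a \<in> T" "b \<in> V" "b \<notin> neighbors G T" for a b
      using that by (auto simp: neighbors_def A_def V_def)
    show "8 * card T \<le> card V"
      using T(2) assms(7) \<open>card V = 2 * N\<close> by linarith
  qed (use bound' \<open>0 \<le> \<mu>\<close> \<open>\<mu> \<le> \<Lambda>\<close> \<open>\<mu> < real L\<close> in \<open>auto simp: A_def\<close>)

  let ?\<T> = "{T. T \<subseteq> gradients E \<and> card T = \<eta>}"
  have "\<eta> \<le> card (gradients E)"
    using assms(7) by (simp add: gradients_def dims card_image inj_on_def)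
  then have "?\<T> \<noteq> {}"
    by (metis (mono_tags, lifting) empty_Collect_eq obtain_subset_with_card_n)
  moreover have "finite ?\<T>"
    by (rule finite_subset[of _ "Pow (gradients E)"]) (auto simp: gradients_def)
  \<comment> \<open>The family of candidate sets is finite and nonempty, so the minimum is attained
    by some \<open>T\<close>, to which the expansion bound applies.\<close>
  ultimately have "adversarial_threshold E \<eta> \<in> (\<lambda>T. card (neighbors (code_graph E) T)) ` ?\<T>"
    unfolding adversarial_threshold_def by (intro Min_in) auto
  then have "(3 * real L - \<Lambda>) * real \<eta> \<le> (real L + \<Lambda>) * real (adversarial_threshold E \<eta>)"
    using expansion by (auto simp: G_def)
  moreover have "real L + \<Lambda> > 0"
    using \<open>0 \<le> \<mu>\<close> \<open>\<mu> \<le> \<Lambda>\<close> \<open>\<mu> < real L\<close> by linarith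
  ultimately show ?thesis
    by (simp add: \<Lambda>_def field_simps)
qed

end
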